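(* For every positive integer $n$, the number of dotted compositions of degree $n$ is $2\cdot3^{n-1}$.
   Context: Let $\mathbb N=\{1,2,\ldots\}$ and $\dot{\mathbb N}_0=\{\dot0,\dot1,\dot2,\ldots\}$ (dotted copies of the nonnegative integers, disjoint from $\mathbb N$). A dotted composition is a finite tuple $\alpha=(\alpha_1,\ldots,\alpha_k)$ with entries in $\mathbb N\cup\dot{\mathbb N}_0$. Its degree is the number of dotted entries plus the sum of the numerical values of all its entries (the numerical value of $\dot m$ is $m$). *)

theory Defs
  imports Main
begin

text \<open>
  The two constructors keep the undotted and the dotted integers disjoint.  The type also
  contains the undotted zero \<open>Undotted 0\<close>, which is not a legal entry; it is excluded by
  \<open>entries\<close>.
\<close>

datatype entry = Undotted nat | Dotted nat

definition entries :: "entry set" where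
  "entries = Undotted ` {1..} \<union> range Dotted"

fun numval :: "entry \<Rightarrow> nat" where
  "numval (Undotted m) = m"
| "numval (Dotted m) = m"

fun is_dotted :: "entry \<Rightarrow> bool" where
  "is_dotted (Undotted m) \<longleftrightarrow> False"
| "is_dotted (Dotted m) \<longleftrightarrow> True"

definition dotted_compositions :: "entry list set" where
  "dotted_compositions = lists entries"

definition degree :: "entry list \<Rightarrow> nat" where
  "degree \<alpha> = length (filter is_dotted \<alpha>) + sum_list (map numval \<alpha>)"

end

theory Submission
  imports Defs
begin

text \<open>
  Passing from degree \<open>n\<close> to degree \<open>n + 1\<close> triples the count. The entries that contribute 1 to
  the degree are \<open>Undotted 1\<close> and \<open>Dotted 0\<close>, and every other entry is obtained in a unique way
  from one contributing 1 less by raising its numerical value. So a dotted composition of degree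
  \<open>n + 1 \<ge> 2\<close> arises in exactly one way from one of degree \<open>n\<close>: either prepend one of the two
  minimal entries, or raise the first entry by 1 (lemma \<open>of_degree_Suc\<close>). Starting from the two
  dotted compositions of degree 1, this gives \<open>2 * 3 ^ (n - 1)\<close>.
\<close>

abbreviation of_degree :: "nat \<Rightarrow> entry list set" where
  "of_degree n \<equiv> {\<alpha> \<in> dotted_compositions. degree \<alpha> = n}"

fun raise_first :: "entry list \<Rightarrow> entry list" where
  "raise_first [] = []"
| "raise_first (Undotted m # \<alpha>) = Undotted (Suc m) # \<alpha>"
| "raise_first (Dotted m # \<alpha>) = Dotted (Suc m) # \<alpha>"

lemma mem_entries [simp]:
  "Undotted m \<in> entries \<longleftrightarrow> m \<ge> 1"
  "Dotted m \<in> entries"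
  by (auto simp: entries_def)

lemma dotted_compositions_simps [simp]:
  "[] \<in> dotted_compositions"
  "e # \<alpha> \<in> dotted_compositions \<longleftrightarrow> e \<in> entries \<and> \<alpha> \<in> dotted_compositions"
  by (simp_all add: dotted_compositions_def)

lemma degree_simps [simp]:
  "degree [] = 0"
  "degree (Undotted m # \<alpha>) = m + degree \<alpha>"
  "degree (Dotted m # \<alpha>) = Suc m + degree \<alpha>"
  by (simp_all add: degree_def)

lemma inj_raise_first: "inj raise_first"
proof (rule injI)
  fix \<alpha> \<beta>
  assume "raise_first \<alpha> = raise_first \<beta>"
  then show "\<alpha> = \<beta>"
    by (cases \<alpha> rule: raise_first.cases; cases \<beta> rule: raise_first.cases) auto
qed

lemma of_degree_0: "of_degree 0 = {[]}"
proof -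
  have "\<alpha> = []" if "\<alpha> \<in> of_degree 0" for \<alpha>
    using that by (cases \<alpha> rule: raise_first.cases) auto
  then show ?thesis by auto
qed

text \<open>
  The converse operation inspects the first entry: if it is minimal, remove it; otherwise lower
  it by 1. Degree 0 is exceptional because the empty composition has no first entry to raise.
\<close>

lemma of_degree_Suc:
  assumes "n \<ge> 1"
  shows "of_degree (Suc n) =
    Cons (Undotted 1) ` of_degree n \<union> Cons (Dotted 0) ` of_degree n \<union> raise_first ` of_degree n"
    (is "_ = ?A \<union> ?B \<union> ?C")
proof (intro equalityI subsetI)
  fix \<alpha>
  assume \<alpha>: "\<alpha> \<in> of_degree (Suc n)"
  show "\<alpha> \<in> ?A \<union> ?B \<union> ?C"
  proof (cases \<alpha> rule: raise_first.cases)
    case 1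
    then show ?thesis using \<alpha> by simp
  next
    case (2 m \<beta>)
    show ?thesis
    proof (cases "m = 1")
      case True
      then show ?thesis using \<alpha> 2 by auto
    next
      case False
      then have "\<alpha> = raise_first (Undotted (m - 1) # \<beta>)" "Undotted (m - 1) # \<beta> \<in> of_degree n"
        using \<alpha> 2 by auto
      then show ?thesis by blast
    qed
  next
    case (3 m \<beta>)
    show ?thesis
    proof (cases "m = 0")
      case True
      then show ?thesis using \<alpha> 3 by auto
    next
      case False
      then have "\<alpha> = raise_first (Dotted (m - 1) # \<beta>)" "Dotted (m - 1) # \<beta> \<in> of_degree n"
        using \<alpha> 3 by auto
      then show ?thesis by blast
    qed
  qed
next
  fix \<alpha>
  assume "\<alpha> \<in> ?A \<union> ?B \<union> ?C"
  moreover have "raise_first \<beta> \<in> of_degree (Suc n)" if "\<beta> \<in> of_degree n" for \<beta>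
    using that assms by (cases \<beta> rule: raise_first.cases) auto
  ultimately show "\<alpha> \<in> of_degree (Suc n)"
    by auto
qed

lemma of_degree_1: "of_degree 1 = {[Undotted 1], [Dotted 0]}"
proof -
  have "\<alpha> = [Undotted 1] \<or> \<alpha> = [Dotted 0]" if \<alpha>: "\<alpha> \<in> of_degree 1" for \<alpha>
  proof (cases \<alpha> rule: raise_first.cases)
    case 1
    then show ?thesis using \<alpha> by simp
  next
    case (2 m \<beta>)
    then have "m = 1" "\<beta> \<in> of_degree 0" using \<alpha> by auto
    then show ?thesis using 2 of_degree_0 by blast
  next
    case (3 m \<beta>)
    then have "m = 0" "\<beta> \<in> of_degree 0" using \<alpha> by auto
    then show ?thesis using 3 of_degree_0 by blast
  qed
  then show ?thesis by auto
qed

text \<open>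
  A raised first entry is never minimal, since undotted entries start at 1 and dotted ones at 0;
  hence the three ways of increasing the degree never produce the same composition.
\<close>

lemma raise_first_not_minimal:
  assumes "\<alpha> \<in> dotted_compositions"
  shows "raise_first \<alpha> \<noteq> Undotted 1 # \<beta>" "raise_first \<alpha> \<noteq> Dotted 0 # \<beta>"
  using assms by (cases \<alpha> rule: raise_first.cases; auto)+

text \<open>
  Finiteness has to be carried through the induction, as cardinalities add only over finite sets.
\<close>

lemma finite_card_of_degree_Suc:
  "finite (of_degree (Suc n)) \<and> card (of_degree (Suc n)) = 2 * 3 ^ n"
proof (induction n)
  case 0
  show ?case using of_degree_1 by simp
next
  case (Suc n)
  let ?S = "of_degree (Suc n)"
  let ?A = "Cons (Undotted 1) ` ?S" and ?B = "Cons (Dotted 0) ` ?S" and ?C = "raise_first ` ?S"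
  have fin: "finite ?S" and card_S: "card ?S = 2 * 3 ^ n"
    using Suc.IH by auto
  have split: "of_degree (Suc (Suc n)) = ?A \<union> ?B \<union> ?C"
    by (rule of_degree_Suc) simp
  have "?A \<inter> ?B = {}"
    by blast
  moreover have "(?A \<union> ?B) \<inter> ?C = {}"
    using raise_first_not_minimal by fastforce
  ultimately have "card (?A \<union> ?B \<union> ?C) = card ?A + card ?B + card ?C"
    using fin by (simp add: card_Un_disjoint)
  moreover have "card ?A = card ?S" "card ?B = card ?S"
    by (simp_all add: card_image)
  moreover have "card ?C = card ?S"
    using inj_raise_first by (intro card_image) (rule inj_on_subset, auto)
  ultimately have "card (of_degree (Suc (Suc n))) = 2 * 3 ^ Suc n"
    unfolding split using card_S by simp
  moreover have "finite (of_degree (Suc (Suc n)))"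
    unfolding split using fin by blast
  ultimately show ?case by blast
qed

theorem proposition3p1:
  fixes n :: nat
  assumes "n \<ge> 1"
  shows "card {\<alpha> \<in> dotted_compositions. degree \<alpha> = n} = 2 * 3 ^ (n - 1)"
  using finite_card_of_degree_Suc[of "n - 1"] assms by simp

end
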